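(* Let $\sigma > 0$ and let $s$ be the unique maximal real solution of $s''(t) = 2 s(t)^3 + t\, s(t)$ with $s(0) = 0$ and $s'(0) = \sigma$, defined on its maximal open interval of existence $I_s \ni 0$. Let $t_\infty > 0$ be the real number such that $I_s \cap [0,\infty) = [0, t_\infty)$. Then $$t_\infty < \frac{2}{\sqrt{\sigma}}.$$
   Context: All functions are real-valued functions of a real variable $t$. The maximal interval $I_s$ is the largest open interval about $0$ on which the solution of the initial value problem exists. The number $t_\infty = \sup I_s$ is the positive blow-up time of $s$; it is finite for every $\sigma > 0$. *)

theory Defs
  imports "HOL-Analysis.Analysis"
begin

text \<open>
  The initial value problem \<open>s'' = 2 s\<^sup>3 + t s\<close>, \<open>s(0) = 0\<close>, \<open>s'(0) = \<sigma>\<close> on an open interval \<open>I\<close>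
  about \<open>0\<close>. The values of \<open>s\<close> outside \<open>I\<close> are irrelevant; since \<open>I\<close> is open, the derivatives
  at points of \<open>I\<close> depend only on \<open>s\<close> restricted to \<open>I\<close>.
\<close>

definition solves_ivp :: "real \<Rightarrow> (real \<Rightarrow> real) \<Rightarrow> real set \<Rightarrow> bool" where
  "solves_ivp \<sigma> s I \<longleftrightarrow>
     open I \<and> is_interval I \<and> 0 \<in> I \<and>
     (\<exists>s'. (\<forall>t\<in>I. (s has_real_derivative s' t) (at t)) \<and>
           (\<forall>t\<in>I. (s' has_real_derivative (2 * s t ^ 3 + t * s t)) (at t)) \<and>
           s 0 = 0 \<and> s' 0 = \<sigma>)"

text \<open>
  \<open>I\<close> is the largest open interval about \<open>0\<close> carrying a solution. Agreement of \<open>u\<close> with \<open>s\<close> on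
  \<open>J\<close> need not be demanded, because the right-hand side is locally Lipschitz in \<open>s\<close>.
\<close>

definition maximal_solution :: "real \<Rightarrow> (real \<Rightarrow> real) \<Rightarrow> real set \<Rightarrow> bool" where
  "maximal_solution \<sigma> s I \<longleftrightarrow>
     solves_ivp \<sigma> s I \<and> (\<forall>u J. solves_ivp \<sigma> u J \<longrightarrow> J \<subseteq> I)"

end

theory Submission
  imports Defs
begin

text \<open>
  For \<open>t \<ge> 0\<close> the term \<open>t s\<close> only accelerates the growth of the solution. Indeed \<open>s s'\<close> has the
  derivative \<open>s'\<^sup>2 + 2 s\<^sup>4 + t s\<^sup>2 \<ge> 0\<close> and vanishes at \<open>0\<close>, so \<open>s s' \<ge> 0\<close>; hence the energy
  \<open>s'\<^sup>2 - s\<^sup>4\<close>, whose derivative is \<open>2 t s s'\<close>, never falls below its initial value \<open>\<sigma>\<^sup>2\<close>.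
  In particular \<open>s'\<close> has no zero, so it stays positive, and \<open>s' \<ge> \<sigma>\<close> as well as \<open>s' \<ge> s\<^sup>2\<close>.

  These two lower bounds are used one after the other, each costing a time less than
  \<open>T = 1 / sqrt \<sigma>\<close>. The first gives linear growth up to the time \<open>T\<close>, where
  \<open>s(T) > \<sigma> T = sqrt \<sigma>\<close>. The second is the Riccati inequality: \<open>1 / s\<close> decreases at least at
  unit rate and would reach \<open>0\<close> by the time \<open>T + 1 / s(T) < 2 T\<close>. So the solution cannot live
  up to \<open>2 T\<close>. (Integrating \<open>s' \<ge> sqrt (\<sigma>\<^sup>2 + s\<^sup>4)\<close> exactly would replace \<open>2\<close> by the elliptic
  integral of \<open>1 / sqrt (1 + u\<^sup>4)\<close> over the positive half-line, about \<open>1.854\<close>.)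
\<close>

context
  fixes s s' :: "real \<Rightarrow> real" and \<sigma> b :: real
  assumes sigma_pos: "\<sigma> > 0"
    and deriv_s: "\<And>t. 0 \<le> t \<Longrightarrow> t < b \<Longrightarrow> (s has_real_derivative s' t) (at t)"
    and deriv_s': "\<And>t. 0 \<le> t \<Longrightarrow> t < b \<Longrightarrow>
          (s' has_real_derivative (2 * s t ^ 3 + t * s t)) (at t)"
    and init: "s 0 = 0" "s' 0 = \<sigma>"
begin

lemma solution_times_derivative_nonneg:
  assumes "0 \<le> t" "t < b"
  shows "s t * s' t \<ge> 0"
proof -
  have "s 0 * s' 0 \<le> s t * s' t"
  proof (rule DERIV_nonneg_imp_nondecreasing[OF assms(1)])
    fix x assume x: "0 \<le> x" "x \<le> t"
    have "((\<lambda>x. s x * s' x) has_real_derivative (s' x)\<^sup>2 + 2 * s x ^ 4 + x * (s x)\<^sup>2) (at x)"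
      by (rule DERIV_cong[OF DERIV_mult[OF deriv_s deriv_s']])
        (use x assms in \<open>simp_all add: algebra_simps eval_nat_numeral\<close>)
    moreover have "(s' x)\<^sup>2 + 2 * s x ^ 4 + x * (s x)\<^sup>2 \<ge> 0"
      using x by simp
    ultimately show "\<exists>y. ((\<lambda>x. s x * s' x) has_real_derivative y) (at x) \<and> 0 \<le> y"
      by blast
  qed
  then show ?thesis
    by (simp add: init)
qed

text \<open>
  Without the term \<open>t s\<close> the energy \<open>s'\<^sup>2 - s\<^sup>4\<close> would be conserved; that term adds the power
  \<open>2 t s s'\<close>, which is nonnegative.
\<close>

lemma energy_lower_bound:
  assumes "0 \<le> t" "t < b"
  shows "\<sigma>\<^sup>2 + s t ^ 4 \<le> (s' t)\<^sup>2"
proof -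
  have "(s' 0)\<^sup>2 - s 0 ^ 4 \<le> (s' t)\<^sup>2 - s t ^ 4"
  proof (rule DERIV_nonneg_imp_nondecreasing[OF assms(1)])
    fix x assume x: "0 \<le> x" "x \<le> t"
    have "((\<lambda>x. (s' x)\<^sup>2 - s x ^ 4) has_real_derivative 2 * x * (s x * s' x)) (at x)"
      by (rule DERIV_cong[OF DERIV_diff[OF DERIV_power[OF deriv_s'] DERIV_power[OF deriv_s]]])
        (use x assms in \<open>simp_all add: algebra_simps eval_nat_numeral\<close>)
    moreover have "2 * x * (s x * s' x) \<ge> 0"
      using x assms mult_nonneg_nonneg[OF _ solution_times_derivative_nonneg[of x], of "2 * x"]
      by simp
    ultimately show "\<exists>y. ((\<lambda>x. (s' x)\<^sup>2 - s x ^ 4) has_real_derivative y) (at x) \<and> 0 \<le> y"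
      by blast
  qed
  then show ?thesis
    by (simp add: init)
qed

text \<open>
  The energy bound keeps \<open>s'\<close> away from \<open>0\<close>, so by continuity \<open>s'\<close> keeps the sign of \<open>s'(0) = \<sigma>\<close>.
\<close>

lemma derivative_pos:
  assumes "0 \<le> t" "t < b"
  shows "s' t > 0"
proof (rule ccontr)
  assume "\<not> s' t > 0"
  moreover have "continuous_on {0..t} s'"
    using assms by (auto intro!: continuous_at_imp_continuous_on DERIV_isCont deriv_s')
  ultimately obtain x where x: "0 \<le> x" "x \<le> t" "s' x = 0"
    using IVT2'[of s' t 0 0] assms sigma_pos init by auto
  then have "\<sigma>\<^sup>2 + s x ^ 4 \<le> 0"
    using energy_lower_bound[of x] assms by simp
  moreover have "\<sigma>\<^sup>2 > 0" "s x ^ 4 \<ge> 0"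
    using sigma_pos by simp_all
  ultimately show False
    by linarith
qed

lemma solution_pos:
  assumes "0 < t" "t < b"
  shows "s t > 0"
proof -
  have "s 0 < s t"
  proof (rule DERIV_pos_imp_increasing[OF assms(1)])
    fix x assume "0 \<le> x" "x \<le> t"
    then show "\<exists>y. (s has_real_derivative y) (at x) \<and> 0 < y"
      using assms deriv_s[of x] derivative_pos[of x] by auto
  qed
  then show ?thesis
    by (simp add: init)
qed

lemma derivative_gt_initial_slope:
  assumes "0 < t" "t < b"
  shows "s' t > \<sigma>"
proof -
  have "\<sigma>\<^sup>2 < (s' t)\<^sup>2"
    using energy_lower_bound[of t] zero_less_power[OF solution_pos[OF assms], of 4] assms
    by linarith
  then show ?thesis
    using derivative_pos[of t] assms by (auto intro: power_less_imp_less_base[of _ 2])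
qed

lemma riccati_inequality:
  assumes "0 \<le> t" "t < b"
  shows "(s t)\<^sup>2 \<le> s' t"
proof -
  have "((s t)\<^sup>2)\<^sup>2 = s t ^ 4"
    by simp
  then have "((s t)\<^sup>2)\<^sup>2 \<le> (s' t)\<^sup>2"
    using energy_lower_bound[OF assms] zero_le_power2[of \<sigma>] by linarith
  then show ?thesis
    using derivative_pos[OF assms] by (auto intro: power2_le_imp_le)
qed

lemma solution_gt_tangent_line:
  assumes "0 < t" "t < b"
  shows "s t > \<sigma> * t"
proof -
  obtain z where z: "0 < z" "z < t" "s t - s 0 = (t - 0) * s' z"
    using MVT2[of 0 t s s'] deriv_s assms by auto
  then have "s t = t * s' z"
    by (simp add: init)
  moreover have "s' z > \<sigma>"
    using z assms by (intro derivative_gt_initial_slope) auto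
  ultimately show ?thesis
    using assms by (simp add: mult.commute)
qed

text \<open>
  By the Riccati inequality \<open>t + 1 / s(t)\<close> is nonincreasing. At the time \<open>T + 1 / s(T)\<close> this would
  leave no room for a positive value of \<open>1 / s\<close>.
\<close>

lemma remaining_lifespan_le:
  assumes "0 < T" "T < b"
  shows "b \<le> T + 1 / s T"
proof (rule ccontr)
  define t where "t = T + 1 / s T"
  assume "\<not> b \<le> T + 1 / s T"
  then have t: "T < t" "t < b"
    using solution_pos[OF assms] by (auto simp: t_def)
  have "t + 1 / s t \<le> T + 1 / s T"
  proof (rule DERIV_nonpos_imp_nonincreasing[where f = "\<lambda>x. x + 1 / s x", OF less_imp_le[OF t(1)]])
    fix x assume x: "T \<le> x" "x \<le> t"
    have pos: "s x > 0"
      using x t assms by (intro solution_pos) auto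
    have "((\<lambda>x. x + 1 / s x) has_real_derivative 1 - s' x / (s x)\<^sup>2) (at x)"
      by (rule DERIV_cong[OF DERIV_add[OF DERIV_ident DERIV_divide[OF DERIV_const deriv_s]]])
        (use x t assms pos in \<open>simp_all add: power2_eq_square\<close>)
    moreover have "1 - s' x / (s x)\<^sup>2 \<le> 0"
      using riccati_inequality[of x] pos x t assms by (simp add: field_simps)
    ultimately show "\<exists>y. ((\<lambda>x. x + 1 / s x) has_real_derivative y) (at x) \<and> y \<le> 0"
      by blast
  qed
  moreover have "s t > 0"
    using t assms by (intro solution_pos) auto
  then have "1 / s t > 0"
    by simp
  ultimately show False
    by (simp add: t_def)
qed

lemma lifespan_bound: "b < 2 / sqrt \<sigma>"
proof (cases "1 / sqrt \<sigma> < b")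
  case True
  define T where "T = 1 / sqrt \<sigma>"
  have T: "0 < T" "T < b"
    using True sigma_pos by (auto simp: T_def)
  have "\<sigma> * T = sqrt \<sigma>"
    using sigma_pos by (simp add: T_def real_div_sqrt)
  then have "s T > sqrt \<sigma>"
    using solution_gt_tangent_line[OF T] by simp
  then have "1 / s T < T"
    using sigma_pos frac_less2[of 1 1 "sqrt \<sigma>" "s T"]
    by (simp add: T_def)
  then have "b < 2 * T"
    using remaining_lifespan_le[OF T] by simp
  then show ?thesis
    by (simp add: T_def)
next
  case False
  moreover have "1 / sqrt \<sigma> < 2 / sqrt \<sigma>"
    using sigma_pos by (simp add: divide_strict_right_mono)
  ultimately show ?thesis
    by linarith
qed

end

theorem theorem2:
  fixes \<sigma> t_inf :: real and s :: "real \<Rightarrow> real" and I :: "real set"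
  assumes "\<sigma> > 0"
    and "maximal_solution \<sigma> s I"
    and "t_inf > 0"
    and "I \<inter> {0..} = {0..<t_inf}"
  shows "t_inf < 2 / sqrt \<sigma>"
proof -
  obtain s' where s': "\<And>t. t \<in> I \<Longrightarrow> (s has_real_derivative s' t) (at t)"
      "\<And>t. t \<in> I \<Longrightarrow> (s' has_real_derivative (2 * s t ^ 3 + t * s t)) (at t)"
      "s 0 = 0" "s' 0 = \<sigma>"
    using assms(2) unfolding maximal_solution_def solves_ivp_def by blast
  have "t \<in> I" if "0 \<le> t" "t < t_inf" for t
    using that assms(4) by (metis IntD1 atLeastLessThan_iff)
  then show ?thesis
    using lifespan_bound[OF assms(1), of t_inf s s'] s' by blast
qed

end
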